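(* There is a constant $p_0$ such that the following holds for every prime $p\ge p_0$. Put $T=\varphi(p-1)-1$ and let $q$ be the smallest prime divisor of $2^T-1$. Let $(s_n)$ be the $T$-periodic binary sequence with $s_n\equiv g_{n+1}+g_{n+2}\bmod 2$ for $n=0,1,\ldots,T-1$, where $1<g_1<g_2<\cdots<g_{\varphi(p-1)}<p-1$ are all primitive roots modulo $p$ in increasing order. Then the $2$-adic complexity $C(s_n)$ of $(s_n)$ satisfies $$C(s_n)\ge \lfloor\log_2(q)\rfloor.$$ In particular, if $2^T-1$ is a (Mersenne) prime, then $$C(s_n)=\lfloor\log_2(2^T-1)\rfloor.$$
   Context: $\varphi$ is Euler's totient function and $\log_2$ is the binary logarithm. The $2$-adic complexity of a $T$-periodic binary sequence $(s_n)$ with $s_n\in\{0,1\}$ (the length of the shortest feedback with carry shift register generating it) is given by $$C(s_n)=\left\lfloor\log_2\left(\frac{2^T-1}{\gcd(2^T-1,S(2))}\right)\right\rfloor,\qquad S(2)=\sum_{n=0}^{T-1}s_n2^n\in\mathbb{Z}.$$ *)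

theory Defs
  imports "HOL-Number_Theory.Number_Theory" Complex_Main
begin

definition binary_periodic :: "nat \<Rightarrow> (nat \<Rightarrow> nat) \<Rightarrow> bool" where
  "binary_periodic T s \<longleftrightarrow> 0 < T \<and> (\<forall>n. s n \<in> {0, 1}) \<and> (\<forall>n. s (n + T) = s n)"

definition period_value :: "nat \<Rightarrow> (nat \<Rightarrow> nat) \<Rightarrow> nat" where
  "period_value T s = (\<Sum>n<T. s n * 2 ^ n)"

(* The 2-adic value of a T-periodic binary s is - period_value T s / (2 ^ T - 1), so the
   number below does not depend on which period T > 0 of s is used. *)
definition two_adic_complexity :: "nat \<Rightarrow> (nat \<Rightarrow> nat) \<Rightarrow> int" where
  "two_adic_complexity T s =
     \<lfloor>log 2 (real (2 ^ T - 1) / real (gcd (2 ^ T - 1) (period_value T s)))\<rfloor>"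

(* g 1 < ... < g (totient (p - 1)) are all primitive roots modulo p in {2..p - 2};
   other values of g are irrelevant. For primes p > 3 the bounds exclude no residue class
   of primitive roots. *)
definition primroot_enumeration :: "nat \<Rightarrow> (nat \<Rightarrow> nat) \<Rightarrow> bool" where
  "primroot_enumeration p g \<longleftrightarrow>
     strict_mono_on {1..totient (p - 1)} g \<and>
     g ` {1..totient (p - 1)} = {x. 1 < x \<and> x < p - 1 \<and> residue_primroot p x}"

end

theory Submission
  imports Defs
begin

text \<open>
  The complexity is at least \<open>\<lfloor>log 2 q\<rfloor>\<close> unless \<open>s\<close> is constant on a period, since otherwise
  \<open>0 < S(2) < 2 ^ T - 1\<close> and the quotient \<open>(2 ^ T - 1) / gcd\<close> is a divisor of \<open>2 ^ T - 1\<close> greater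
  than 1. If \<open>s\<close> is constantly 0, then all primitive roots have the same parity; if it is
  constantly 1, then their parities alternate.

  Let \<open>f\<close> be the indicator function of the primitive roots modulo \<open>p\<close>, \<open>\<delta> = totient (p - 1) / (p - 1)\<close>
  and \<open>D = 2 ^ \<omega>(p - 1)\<close>. Expanding \<open>f\<close> into multiplicative characters gives, for \<open>h\<close> not divisible by \<open>p\<close>,
  the correlation \<open>\<Sum>x. f x * f (x + h) = \<delta>\<^sup>2 * (p - 2) + O(D\<^sup>2 * sqrt p)\<close>; the bound \<open>sqrt p\<close> for the
  correlation of two characters follows from its second moment over \<open>h\<close>, because scaling makes its
  absolute value independent of \<open>h\<close>.

  For \<open>h = 1\<close> the correlation is positive, so two adjacent residues are primitive roots and not all
  parities agree. If the parities alternated, the sums of \<open>(- 1) ^ x * f x\<close> over windows of length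
  \<open>L = 4 * D\<close> would be bounded by 1, whereas by the correlations their mean square is about
  \<open>L * \<delta> * (1 - \<delta>) \<ge> 2\<close>. The bound \<open>D ^ 9 = O(p)\<close> makes the error terms negligible.
\<close>

subsection \<open>Multiplicative characters modulo a prime\<close>

text \<open>Dirichlet characters modulo \<open>p\<close>, kept as periodic functions on all integers
  so that shifts \<open>x + h\<close> need no reduction. Prescribing the norm makes the conjugate
  the inverse away from the multiples of \<open>p\<close>.\<close>

definition mod_character :: "int \<Rightarrow> (int \<Rightarrow> complex) \<Rightarrow> bool" where
  "mod_character p \<chi> \<longleftrightarrow>
     (\<forall>x. \<chi> (x mod p) = \<chi> x) \<and> (\<forall>x y. \<chi> (x * y) = \<chi> x * \<chi> y) \<and>
     (\<forall>x. norm (\<chi> x) = (if p dvd x then 0 else 1))"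

definition principal_character :: "int \<Rightarrow> int \<Rightarrow> complex" where
  "principal_character p x = (if p dvd x then 0 else 1)"

section \<open>Sums over a complete residue system\<close>

lemma sum_residues_shift:
  fixes F :: "int \<Rightarrow> 'a :: comm_monoid_add"
  assumes "p > 0" and "\<And>x. F (x mod p) = F x"
  shows "(\<Sum>x\<in>{0..<p}. F (x + c)) = (\<Sum>x\<in>{0..<p}. F x)"
proof (rule sum.reindex_bij_witness[of _ "\<lambda>y. (y - c) mod p" "\<lambda>x. (x + c) mod p"])
  fix x assume "x \<in> {0..<p}"
  then show "((x + c) mod p - c) mod p = x" "((x - c) mod p + c) mod p = x"
    by (simp_all add: mod_diff_left_eq mod_add_left_eq)
qed (use assms in auto)

lemma sum_residues_scale:
  fixes F :: "int \<Rightarrow> 'a :: comm_monoid_add"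
  assumes "p > 0" and "\<And>x. F (x mod p) = F x" and "coprime a p"
  shows "(\<Sum>x\<in>{0..<p}. F (a * x)) = (\<Sum>x\<in>{0..<p}. F x)"
proof -
  obtain b where b: "[a * b = 1] (mod p)"
    using cong_solve_coprime_int[OF \<open>coprime a p\<close>] by blast
  have inv: "(a * b * x) mod p = x" if "x \<in> {0..<p}" for x
    using b that by (metis cong_def cong_scalar_right mult_1 atLeastLessThan_iff mod_pos_pos_trivial)
  show ?thesis
  proof (rule sum.reindex_bij_witness[of _ "\<lambda>y. (b * y) mod p" "\<lambda>x. (a * x) mod p"])
    fix x assume x: "x \<in> {0..<p}"
    show "b * (a * x mod p) mod p = x" "a * (b * x mod p) mod p = x"
      using inv[OF x] by (simp_all add: mod_mult_right_eq ac_simps)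
  qed (use assms in auto)
qed

lemma mod_character_mod: "mod_character p \<chi> \<Longrightarrow> \<chi> (x mod p) = \<chi> x"
  and mod_character_mult: "mod_character p \<chi> \<Longrightarrow> \<chi> (x * y) = \<chi> x * \<chi> y"
  and mod_character_norm: "mod_character p \<chi> \<Longrightarrow> norm (\<chi> x) = (if p dvd x then 0 else 1)"
  by (simp_all add: mod_character_def)

lemma mod_character_mod_add:
  "mod_character p \<chi> \<Longrightarrow> \<chi> (x mod p + c) = \<chi> (x + c)"
  by (metis mod_character_mod mod_add_left_eq)

lemma mod_character_cnj:
  "mod_character p \<chi> \<Longrightarrow> \<chi> x * cnj (\<chi> x) = (if p dvd x then 0 else 1)"
  by (simp add: complex_norm_square[symmetric] mod_character_norm)

context
  fixes p :: int
  assumes prime_p: "prime p"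
begin

lemma p_gt_1: "p > 1"
  using prime_p by (rule prime_gt_1_int)

lemma not_dvd_residue: "x \<in> {0..<p} \<Longrightarrow> p dvd x \<longleftrightarrow> x = 0"
  using zdvd_imp_le[of p x] by (cases "x = 0") auto

lemma coprime_iff_not_dvd: "coprime x p \<longleftrightarrow> \<not> p dvd x"
  using prime_p by (metis coprime_commute prime_imp_coprime coprime_absorb_left not_prime_unit)

lemma sum_units_one: "(\<Sum>x\<in>{0..<p}. if p dvd x then 0 else 1 :: 'a :: ring_1) = of_int p - 1"
proof -
  have "(\<Sum>x\<in>{0..<p}. if p dvd x then 0 else 1 :: 'a) = (\<Sum>x\<in>{0..<p} - {0}. 1)"
    using p_gt_1 by (intro sum.mono_neutral_cong_right) (auto simp: not_dvd_residue)
  also have "\<dots> = of_nat (card ({0..<p} - {0}))"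
    by simp
  also have "card ({0..<p} - {0}) = nat p - 1"
    using p_gt_1 by (subst card_Diff_subset) auto
  finally show ?thesis
    using p_gt_1 by (simp add: of_nat_diff)
qed

text \<open>Multiplication by \<open>a\<close> permutes the residues, so the sum equals itself times
  \<open>\<chi> a\<close>, a factor different from 1.\<close>

lemma mod_character_sum:
  assumes \<chi>: "mod_character p \<chi>" and a: "\<not> p dvd a" "\<chi> a \<noteq> 1"
  shows "(\<Sum>x\<in>{0..<p}. \<chi> x) = 0"
proof -
  have "(\<Sum>x\<in>{0..<p}. \<chi> x) = (\<Sum>x\<in>{0..<p}. \<chi> (a * x))"
    using p_gt_1 a \<chi>
    by (intro sum_residues_scale[symmetric]) (auto simp: mod_character_mod coprime_iff_not_dvd)
  also have "\<dots> = \<chi> a * (\<Sum>x\<in>{0..<p}. \<chi> x)"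
    by (simp add: mod_character_mult[OF \<chi>] sum_distrib_left)
  finally show ?thesis
    using a by simp
qed

section \<open>Correlations of two characters\<close>

text \<open>Scaling makes the autocorrelation independent of \<open>c \<noteq> 0\<close>, and its sum over all \<open>c\<close> vanishes.\<close>

lemma mod_character_autocorrelation:
  assumes \<psi>: "mod_character p \<psi>" and a: "\<not> p dvd a" "\<psi> a \<noteq> 1"
  shows "(\<Sum>t\<in>{0..<p}. \<psi> t * cnj (\<psi> (t + c))) = (if p dvd c then of_int p else 0) - 1"
proof -
  define A where "A c = (\<Sum>t\<in>{0..<p}. \<psi> t * cnj (\<psi> (t + c)))" for c
  have p0: "p > 0"
    using p_gt_1 by simp
  have A_scale: "A c = A 1" if "\<not> p dvd c" for c
  proof -
    have "A c = (\<Sum>t\<in>{0..<p}. \<psi> (c * t) * cnj (\<psi> (c * t + c)))"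
      unfolding A_def using that p0 \<psi>
      by (intro sum_residues_scale[symmetric])
         (auto simp: mod_character_mod mod_character_mod_add coprime_iff_not_dvd)
    also have "\<dots> = (\<Sum>t\<in>{0..<p}. (\<psi> c * cnj (\<psi> c)) * (\<psi> t * cnj (\<psi> (t + 1))))"
    proof (intro sum.cong refl)
      fix t
      have "c * t + c = c * (t + 1)"
        by (simp add: algebra_simps)
      then show "\<psi> (c * t) * cnj (\<psi> (c * t + c)) = (\<psi> c * cnj (\<psi> c)) * (\<psi> t * cnj (\<psi> (t + 1)))"
        by (simp only: mod_character_mult[OF \<psi>] complex_cnj_mult ac_simps)
    qed
    also have "\<dots> = A 1"
      using that by (simp add: mod_character_cnj[OF \<psi>] A_def)
    finally show ?thesis .
  qed
  have A_dvd: "A c = of_int p - 1" if "p dvd c" for c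
  proof -
    have "\<psi> (t + c) = \<psi> t" for t
      using that by (metis mod_character_mod[OF \<psi>] mod_add_right_eq dvd_imp_mod_0 add.right_neutral)
    then show ?thesis
      by (simp add: A_def mod_character_cnj[OF \<psi>] sum_units_one)
  qed
  have "(\<Sum>c\<in>{0..<p}. A c) = (\<Sum>t\<in>{0..<p}. \<psi> t * (\<Sum>c\<in>{0..<p}. cnj (\<psi> (c + t))))"
    unfolding A_def by (subst sum.swap) (simp add: sum_distrib_left add.commute)
  also have "\<dots> = (\<Sum>t\<in>{0..<p}. \<psi> t * cnj (\<Sum>c\<in>{0..<p}. \<psi> c))"
    using sum_residues_shift[OF p0, of \<psi>] by (simp add: mod_character_mod[OF \<psi>] flip: cnj_sum)
  also have "\<dots> = 0"
    by (simp add: mod_character_sum[OF \<psi> a])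
  finally have "(\<Sum>c\<in>{0..<p}. A c) = 0" .
  also have "(\<Sum>c\<in>{0..<p}. A c) = A 0 + (\<Sum>c\<in>{0..<p} - {0}. A c)"
    using p0 by (intro sum.remove) auto
  also have "(\<Sum>c\<in>{0..<p} - {0}. A c) = (\<Sum>c\<in>{0..<p} - {0}. A 1)"
    by (intro sum.cong refl A_scale) (auto simp: not_dvd_residue)
  also have "\<dots> = (of_int p - 1) * A 1"
    using p_gt_1 by (simp add: card_Diff_subset of_nat_diff)
  finally have "(of_int p - 1) * (1 + A 1) = 0"
    by (simp add: A_dvd algebra_simps)
  moreover have "of_int p - (1::complex) \<noteq> 0"
    using p_gt_1 by simp
  ultimately have "A 1 = - 1"
    by (metis mult_eq_0_iff add_eq_0_iff)
  then show ?thesis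
    using A_scale A_dvd unfolding A_def[symmetric] by simp
qed

text \<open>Second moment over all shifts: expanding the squares and using the autocorrelation of
  \<open>\<psi>\<close>, the sum of \<open>(norm (B h))\<^sup>2\<close> is p (p - 1) minus the
  squared norm of the sum of \<open>\<chi>\<close>. The p - 1 shifts not divisible by
  \<open>p\<close> contribute equally, so each contributes at most p.\<close>

lemma mod_character_correlation_bound:
  assumes \<chi>: "mod_character p \<chi>" and \<psi>: "mod_character p \<psi>"
    and a: "\<not> p dvd a" "\<psi> a \<noteq> 1" and h: "\<not> p dvd h"
  shows "norm (\<Sum>x\<in>{0..<p}. \<chi> x * \<psi> (x + h)) \<le> sqrt p"
proof -
  define B where "B h = (\<Sum>x\<in>{0..<p}. \<chi> x * \<psi> (x + h))" for h
  have p0: "p > 0"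
    using p_gt_1 by simp
  have B_scale: "norm (B h) = norm (B 1)" if "\<not> p dvd h" for h
  proof -
    have "B h = (\<Sum>t\<in>{0..<p}. \<chi> (h * t) * \<psi> (h * t + h))"
      unfolding B_def using that p0 \<chi> \<psi>
      by (intro sum_residues_scale[symmetric])
         (auto simp: mod_character_mod mod_character_mod_add coprime_iff_not_dvd)
    also have "\<dots> = (\<Sum>t\<in>{0..<p}. (\<chi> h * \<psi> h) * (\<chi> t * \<psi> (t + 1)))"
    proof (intro sum.cong refl)
      fix t
      have "h * t + h = h * (t + 1)"
        by (simp add: algebra_simps)
      then show "\<chi> (h * t) * \<psi> (h * t + h) = (\<chi> h * \<psi> h) * (\<chi> t * \<psi> (t + 1))"
        by (simp only: mod_character_mult[OF \<psi>] mod_character_mult[OF \<chi>] ac_simps)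
    qed
    also have "\<dots> = (\<chi> h * \<psi> h) * B 1"
      by (simp add: B_def sum_distrib_left)
    finally show ?thesis
      using that by (simp add: norm_mult mod_character_norm[OF \<psi>] mod_character_norm[OF \<chi>])
  qed
  \<comment> \<open>The translates of \<open>\<psi>\<close> by distinct residues are orthogonal up
    to the constant - 1, which later separates into the product of two complete sums of
    \<open>\<chi>\<close>.\<close>
  have A: "(\<Sum>h\<in>{0..<p}. \<psi> (x + h) * cnj (\<psi> (x' + h))) = (if x = x' then of_int p else 0) - 1"
    if "x \<in> {0..<p}" "x' \<in> {0..<p}" for x x'
  proof -
    have "(\<Sum>h\<in>{0..<p}. \<psi> (x + h) * cnj (\<psi> (x' + h))) =
        (\<Sum>h\<in>{0..<p}. \<psi> (h + x) * cnj (\<psi> ((h + x) + (x' - x))))"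
      by (simp add: algebra_simps)
    also have "\<dots> = (\<Sum>h\<in>{0..<p}. \<psi> h * cnj (\<psi> (h + (x' - x))))"
      by (intro sum_residues_shift p0) (simp add: mod_character_mod[OF \<psi>] mod_character_mod_add[OF \<psi>])
    also have "\<dots> = (if p dvd x' - x then of_int p else 0) - 1"
      by (rule mod_character_autocorrelation[OF \<psi> a])
    also have "p dvd x' - x \<longleftrightarrow> x = x'"
      using that by (metis atLeastLessThan_iff mod_eq_dvd_iff mod_pos_pos_trivial)
    finally show ?thesis .
  qed
  have "complex_of_real (\<Sum>h\<in>{0..<p}. (norm (B h))\<^sup>2) = (\<Sum>h\<in>{0..<p}. B h * cnj (B h))"
    by (simp only: of_real_sum complex_norm_square)
  also have "\<dots> = (\<Sum>h\<in>{0..<p}. \<Sum>x\<in>{0..<p}. \<Sum>x'\<in>{0..<p}.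
      (\<chi> x * cnj (\<chi> x')) * (\<psi> (x + h) * cnj (\<psi> (x' + h))))"
    unfolding B_def by (simp add: sum_product ac_simps)
  also have "\<dots> = (\<Sum>x\<in>{0..<p}. \<Sum>x'\<in>{0..<p}. \<Sum>h\<in>{0..<p}.
      (\<chi> x * cnj (\<chi> x')) * (\<psi> (x + h) * cnj (\<psi> (x' + h))))"
    by (subst sum.swap, rule sum.cong[OF refl], subst sum.swap) (rule refl)
  also have "\<dots> = (\<Sum>x\<in>{0..<p}. \<Sum>x'\<in>{0..<p}.
      (\<chi> x * cnj (\<chi> x')) * ((if x = x' then of_int p else 0) - 1))"
    by (intro sum.cong refl) (simp add: A flip: sum_distrib_left)
  also have "\<dots> = (\<Sum>x\<in>{0..<p}. of_int p * (\<chi> x * cnj (\<chi> x)) - \<chi> x * cnj (\<Sum>x'\<in>{0..<p}. \<chi> x'))"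
    by (intro sum.cong refl)
       (simp add: right_diff_distrib sum_subtractf if_distrib[of "(*) _"] sum_distrib_left cong: if_cong)
  also have "\<dots> = of_int p * (of_int p - 1) - (\<Sum>x\<in>{0..<p}. \<chi> x) * cnj (\<Sum>x\<in>{0..<p}. \<chi> x)"
    by (simp only: sum_subtractf sum_distrib_left[symmetric] sum_distrib_right[symmetric]
        mod_character_cnj[OF \<chi>] sum_units_one)
  also have "\<dots> = complex_of_real (real_of_int p * (real_of_int p - 1) - (norm (\<Sum>x\<in>{0..<p}. \<chi> x))\<^sup>2)"
    by (simp only: of_real_diff of_real_mult complex_norm_square of_real_of_int_eq of_real_1)
  finally have total: "(\<Sum>h\<in>{0..<p}. (norm (B h))\<^sup>2) \<le> real_of_int p * (real_of_int p - 1)"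
    by (simp only: of_real_eq_iff) simp
  have "(real_of_int p - 1) * (norm (B 1))\<^sup>2 = (\<Sum>h\<in>{0..<p} - {0}. (norm (B 1))\<^sup>2)"
    using p_gt_1 by (simp add: card_Diff_subset of_nat_diff)
  also have "\<dots> = (\<Sum>h\<in>{0..<p} - {0}. (norm (B h))\<^sup>2)"
    by (rule sum.cong[OF refl], subst B_scale) (auto simp: not_dvd_residue)
  also have "\<dots> \<le> (\<Sum>h\<in>{0..<p}. (norm (B h))\<^sup>2)"
    by (intro sum_mono2) auto
  also note total
  finally have "(norm (B 1))\<^sup>2 \<le> real_of_int p"
    using p_gt_1 by (simp add: mult.commute)
  then have "norm (B 1) \<le> sqrt p"
    by (rule real_le_rsqrt)
  then show ?thesis
    using B_scale[OF h] by (simp add: B_def)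
qed

lemma nonprincipal_witness:
  assumes "mod_character p \<chi>" "\<chi> \<noteq> principal_character p"
  obtains a where "\<not> p dvd a" "\<chi> a \<noteq> 1"
proof -
  from assms(2) obtain a where a: "\<chi> a \<noteq> principal_character p a"
    by blast
  moreover have "\<not> p dvd a"
    using a mod_character_norm[OF assms(1), of a] by (auto simp: principal_character_def)
  ultimately show ?thesis
    using that by (simp add: principal_character_def)
qed

text \<open>Exactly the two residues 0 and - h are lost, and they differ because \<open>p\<close>
  does not divide \<open>h\<close>.\<close>

lemma principal_character_correlation:
  assumes "\<not> p dvd h"
  shows "(\<Sum>x\<in>{0..<p}. principal_character p x * principal_character p (x + h)) = of_int p - 2"
proof -
  let ?u = "principal_character p"
  have p0: "p > 0"
    using p_gt_1 by simp
  have "(\<Sum>x\<in>{0..<p}. ?u x * ?u (x + h)) = (\<Sum>x\<in>{0..<p} - {0}. ?u (x + h))"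
    by (intro sum.mono_neutral_cong_right) (auto simp: principal_character_def not_dvd_residue)
  also have "\<dots> = (\<Sum>x\<in>{0..<p}. ?u (x + h)) - ?u h"
    using p0 by (simp add: sum_diff1)
  also have "(\<Sum>x\<in>{0..<p}. ?u (x + h)) = (\<Sum>x\<in>{0..<p}. ?u x)"
    by (intro sum_residues_shift p0) (simp add: principal_character_def dvd_mod_iff)
  also have "\<dots> = of_int p - 1"
    using sum_units_one[where 'a = complex] by (simp add: principal_character_def)
  finally show ?thesis
    using assms by (simp add: principal_character_def)
qed

lemma nonprincipal_correlation_bound:
  assumes \<chi>: "mod_character p \<chi>" and \<psi>: "mod_character p \<psi>"
    and np: "\<chi> \<noteq> principal_character p \<or> \<psi> \<noteq> principal_character p" and h: "\<not> p dvd h"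
  shows "norm (\<Sum>x\<in>{0..<p}. \<chi> x * \<psi> (x + h)) \<le> sqrt p"
proof (cases "\<psi> = principal_character p")
  case False
  then obtain a where "\<not> p dvd a" "\<psi> a \<noteq> 1"
    using nonprincipal_witness[OF \<psi>] by blast
  then show ?thesis
    by (intro mod_character_correlation_bound prime_p \<chi> \<psi> h)
next
  case True
  then obtain a where a: "\<not> p dvd a" "\<chi> a \<noteq> 1"
    using np nonprincipal_witness[OF \<chi>] by blast
  \<comment> \<open>Substituting x - h for x exchanges the two characters and turns the shift into -
    h, so the nonprincipal one takes the second place.\<close>
  have "(\<Sum>x\<in>{0..<p}. \<chi> x * \<psi> (x + h)) = (\<Sum>x\<in>{0..<p}. \<psi> (x + h) * \<chi> ((x + h) + - h))"
    by (simp add: ac_simps)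
  also have "\<dots> = (\<Sum>x\<in>{0..<p}. \<psi> x * \<chi> (x + - h))"
    using p_gt_1
    by (intro sum_residues_shift)
       (simp_all add: mod_character_mod[OF \<psi>] mod_character_mod_add[OF \<chi>] del: add_uminus_conv_diff)
  finally show ?thesis
    using mod_character_correlation_bound[OF \<psi> \<chi> a, of "- h"] h by simp
qed

section \<open>Linear combinations of characters\<close>

lemma character_combination_sum:
  assumes "finite I" and \<chi>: "\<And>i. i \<in> I \<Longrightarrow> mod_character p (\<chi> i)"
    and F: "\<And>x. F x = (\<Sum>i\<in>I. a i * \<chi> i x)"
  shows "(\<Sum>x\<in>{0..<p}. F x) = (\<Sum>i | i \<in> I \<and> \<chi> i = principal_character p. a i) * (of_int p - 1)"
proof -
  have K: "(\<Sum>x\<in>{0..<p}. \<chi> i x) = (if \<chi> i = principal_character p then of_int p - 1 else 0)"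
    if i: "i \<in> I" for i
  proof (cases "\<chi> i = principal_character p")
    case True
    then show ?thesis
      using sum_units_one[where 'a = complex] by (simp add: principal_character_def)
  next
    case False
    then obtain c where "\<not> p dvd c" "\<chi> i c \<noteq> 1"
      using nonprincipal_witness[OF \<chi>[OF i]] by blast
    then show ?thesis
      using False mod_character_sum[OF \<chi>[OF i]] by simp
  qed
  have "(\<Sum>x\<in>{0..<p}. F x) = (\<Sum>i\<in>I. a i * (\<Sum>x\<in>{0..<p}. \<chi> i x))"
    unfolding F by (subst sum.swap) (simp add: sum_distrib_left)
  also have "\<dots> = (\<Sum>i\<in>I. if \<chi> i = principal_character p then a i * (of_int p - 1) else 0)"
    by (intro sum.cong refl) (simp add: K)
  also have "\<dots> = (\<Sum>i | i \<in> I \<and> \<chi> i = principal_character p. a i) * (of_int p - 1)"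
    using \<open>finite I\<close> by (auto simp: sum.inter_filter sum_distrib_right intro!: sum.cong)
  finally show ?thesis .
qed

text \<open>Expand into pairs of characters: a pair of principal ones contributes p - 2 exactly,
  every other pair at most \<open>sqrt p\<close>. As the family may repeat characters, the main term
  has the total coefficient of the principal character.\<close>

lemma character_combination_correlation:
  assumes fin: "finite I" and \<chi>: "\<And>i. i \<in> I \<Longrightarrow> mod_character p (\<chi> i)"
    and F: "\<And>x. F x = (\<Sum>i\<in>I. a i * \<chi> i x)" and h: "\<not> p dvd h"
  shows "norm ((\<Sum>x\<in>{0..<p}. F x * F (x + h)) -
           (\<Sum>i | i \<in> I \<and> \<chi> i = principal_character p. a i)\<^sup>2 * (of_int p - 2))
         \<le> (\<Sum>i\<in>I. norm (a i))\<^sup>2 * sqrt p"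
proof -
  define K where "K i j = (\<Sum>x\<in>{0..<p}. \<chi> i x * \<chi> j (x + h))" for i j
  \<comment> \<open>Masking \<open>a\<close> outside the principal indices lets the main term be
    written as a double sum over all of \<open>I\<close>, to be compared termwise with the
    correlation.\<close>
  define b where "b i = (if \<chi> i = principal_character p then a i else 0)" for i
  define M where "M i j =
    (if \<chi> i = principal_character p \<and> \<chi> j = principal_character p then of_int p - 2 else 0 :: complex)" for i j
  have KM: "norm (K i j - M i j) \<le> sqrt p" if "i \<in> I" "j \<in> I" for i j
  proof (cases "\<chi> i = principal_character p \<and> \<chi> j = principal_character p")
    case True
    then show ?thesis
      using principal_character_correlation[OF h] p_gt_1 by (simp add: K_def M_def)
  next
    case False
    then show ?thesis
      using nonprincipal_correlation_bound[OF \<chi>[OF that(1)] \<chi>[OF that(2)] _ h]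
      by (auto simp: K_def M_def)
  qed
  have "(\<Sum>x\<in>{0..<p}. F x * F (x + h)) =
      (\<Sum>x\<in>{0..<p}. \<Sum>i\<in>I. \<Sum>j\<in>I. a i * a j * (\<chi> i x * \<chi> j (x + h)))"
    unfolding F by (simp add: sum_product ac_simps)
  also have "\<dots> = (\<Sum>i\<in>I. \<Sum>j\<in>I. \<Sum>x\<in>{0..<p}. a i * a j * (\<chi> i x * \<chi> j (x + h)))"
    by (subst sum.swap, rule sum.cong[OF refl], subst sum.swap) (rule refl)
  finally have corr: "(\<Sum>x\<in>{0..<p}. F x * F (x + h)) = (\<Sum>i\<in>I. \<Sum>j\<in>I. a i * a j * K i j)"
    by (simp only: K_def sum_distrib_left)
  have "(\<Sum>i | i \<in> I \<and> \<chi> i = principal_character p. a i) = (\<Sum>i\<in>I. b i)"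
    using fin by (simp add: b_def sum.inter_filter)
  then have "(\<Sum>i | i \<in> I \<and> \<chi> i = principal_character p. a i)\<^sup>2 = (\<Sum>i\<in>I. \<Sum>j\<in>I. b i * b j)"
    by (simp only: power2_eq_square sum_product)
  then have "(\<Sum>i | i \<in> I \<and> \<chi> i = principal_character p. a i)\<^sup>2 * (of_int p - 2) =
      (\<Sum>i\<in>I. \<Sum>j\<in>I. b i * b j * (of_int p - 2))"
    by (simp only: sum_distrib_right)
  also have "\<dots> = (\<Sum>i\<in>I. \<Sum>j\<in>I. a i * a j * M i j)"
    by (intro sum.cong refl) (simp add: b_def M_def)
  finally have main: "(\<Sum>i | i \<in> I \<and> \<chi> i = principal_character p. a i)\<^sup>2 * (of_int p - 2) =
      (\<Sum>i\<in>I. \<Sum>j\<in>I. a i * a j * M i j)" .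
  have "norm ((\<Sum>i\<in>I. \<Sum>j\<in>I. a i * a j * K i j) - (\<Sum>i\<in>I. \<Sum>j\<in>I. a i * a j * M i j)) =
      norm (\<Sum>i\<in>I. \<Sum>j\<in>I. a i * a j * (K i j - M i j))"
    by (simp add: sum_subtractf right_diff_distrib)
  also have "\<dots> \<le> (\<Sum>i\<in>I. \<Sum>j\<in>I. norm (a i) * norm (a j) * sqrt p)"
    by (intro sum_norm_le) (simp add: norm_mult KM mult_left_mono)
  also have "\<dots> = (\<Sum>i\<in>I. norm (a i))\<^sup>2 * sqrt p"
    unfolding power2_eq_square sum_product by (simp only: sum_distrib_right)
  finally show ?thesis
    by (simp only: corr main)
qed

end

subsection \<open>The indicator function of the primitive roots\<close>

lemma cis_neq_1:
  assumes "0 < j" "j < n"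
  shows "cis (2 * pi * real j / real n) \<noteq> 1"
proof
  assume "cis (2 * pi * real j / real n) = 1"
  then have "cos (2 * (pi * (real j / real n))) = 1"
    by (simp add: complex_eq_iff algebra_simps)
  \<comment> \<open>The half angle pi j / n lies strictly between 0 and pi, where the sine is
    positive.\<close>
  then have "1 - 2 * (sin (pi * (real j / real n)))\<^sup>2 = 1"
    by (simp only: cos_double_sin)
  then have "sin (pi * (real j / real n)) = 0"
    by simp
  moreover have "sin (pi * (real j / real n)) > 0"
    using assms by (intro sin_gt_zero) (auto simp: field_simps)
  ultimately show False
    by simp
qed

lemma cis_cong:
  assumes "[a = b] (mod n)" "n > 0"
  shows "cis (2 * pi * real j * real a / real n) = cis (2 * pi * real j * real b / real n)"
proof -
  from assms have "[int a = int b] (mod int n)"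
    by (simp add: cong_int_iff)
  then obtain m where m: "int a = int b + int n * m"
    by (metis cong_iff_lin cong_sym)
  then have "real a = real b + real n * of_int m"
    by (metis of_int_add of_int_mult of_int_of_nat_eq)
  then have "2 * pi * real j * real a / real n =
      2 * pi * real j * real b / real n + 2 * pi * of_int (int j * m)"
    using \<open>n > 0\<close> by (simp add: field_simps)
  then show ?thesis
    by (simp only: cis_mult[symmetric] cis_multiple_2pi[OF Ints_of_int] mult_1_right)
qed

text \<open>The summands are the powers of a single \<open>d\<close>-th root of unity, which is 1
  exactly if \<open>d\<close> divides \<open>k\<close>; otherwise the geometric sum over a full
  period vanishes.\<close>

lemma of_bool_dvd_eq_sum_cis:
  fixes d k :: nat
  assumes "d > 0"
  shows "of_bool (d dvd k) = (\<Sum>i<d. cis (2 * pi * real i * real k / real d)) / of_nat d"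
proof -
  define z where "z = cis (2 * pi * real k / real d)"
  have z: "cis (2 * pi * real i * real k / real d) = z ^ i" for i
    by (simp add: z_def DeMoivre algebra_simps)
  have zk: "z = cis (2 * pi * real (k mod d) / real d)"
    using cis_cong[of k "k mod d" d 1] assms by (simp add: z_def cong_def)
  show ?thesis
  proof (cases "d dvd k")
    case True
    then show ?thesis
      using assms zk by (simp add: z)
  next
    case False
    then have "z \<noteq> 1"
      using cis_neq_1[of "k mod d" d] assms zk by (simp add: mod_greater_zero_iff_not_dvd)
    moreover have "z ^ d = cis (2 * pi * real k)"
      using assms by (simp add: z_def DeMoivre)
    then have "z ^ d = 1"
      by (simp only: cis_multiple_2pi[OF Ints_of_nat])
    ultimately show ?thesis
      using False by (simp add: z geometric_sum)
  qed
qed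

text \<open>Inclusion-exclusion: expand the product of 1 - [q dvd k] over the primes
  \<open>q\<close> of \<open>n\<close>. This is the Moebius sum over squarefree divisors, indexed by
  sets of primes so that the number of terms is visibly 2 to the number of primes.\<close>

lemma of_bool_coprime_eq_sum:
  fixes k n :: nat
  assumes "n > 0"
  shows "of_bool (coprime k n) =
    (\<Sum>S\<in>Pow (prime_factors n). (- 1) ^ card S * of_bool (\<Prod>S dvd k) :: 'a :: comm_ring_1)"
proof -
  let ?P = "prime_factors n"
  have "of_bool (coprime k n) = (\<Prod>q\<in>?P. - of_bool (q dvd k) + 1 :: 'a)"
  proof (cases "coprime k n")
    case True
    have "\<not> q dvd k" if "q \<in> ?P" for q
      using that True by (auto dest: coprime_common_divisor_nat simp: in_prime_factors_iff)
    then show ?thesis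
      using True by simp
  next
    case False
    then obtain q where "prime q" "q dvd k" "q dvd n"
      using assms by (metis coprime_iff_gcd_eq_1 gcd_nat.bounded_iff prime_factor_nat)
    then have "q \<in> ?P" "- of_bool (q dvd k) + 1 = (0 :: 'a)"
      using assms by (auto simp: in_prime_factors_iff)
    then show ?thesis
      using False by (metis (mono_tags, lifting) finite_set_mset of_bool_eq(1) prod_zero)
  qed
  also have "\<dots> = (\<Sum>S\<in>Pow ?P. \<Prod>q\<in>S. - of_bool (q dvd k))"
    by (subst prod_add) simp_all
  also have "\<dots> = (\<Sum>S\<in>Pow ?P. (- 1) ^ card S * of_bool (\<Prod>S dvd k))"
  proof (intro sum.cong refl)
    fix S assume "S \<in> Pow ?P"
    then have S: "finite S" "\<And>q. q \<in> S \<Longrightarrow> prime q"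
      by (auto intro: finite_subset simp: in_prime_factors_iff)
    have "\<Prod>S dvd k \<longleftrightarrow> (\<forall>q\<in>S. q dvd k)"
    proof
      assume "\<Prod>S dvd k"
      then show "\<forall>q\<in>S. q dvd k"
        using S(1) by (meson dvd_prodI dvd_trans)
    next
      assume "\<forall>q\<in>S. q dvd k"
      with S show "\<Prod>S dvd k"
      proof (induction S rule: finite_induct)
        case (insert q S)
        have "coprime q (\<Prod>S)"
          using insert by (intro prod_coprime_right) (metis insert_iff primes_coprime)
        then show ?case
          using insert by (simp add: divides_mult)
      qed simp
    qed
    then have "(\<Prod>q\<in>S. of_bool (q dvd k) :: 'a) = of_bool (\<Prod>S dvd k)"
      using S(1) by (cases "\<forall>q\<in>S. q dvd k") (auto intro!: prod_zero)
    moreover have "(\<Prod>q\<in>S. - of_bool (q dvd k) :: 'a) = (- 1) ^ card S * (\<Prod>q\<in>S. of_bool (q dvd k))"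
      by (subst prod_uminus) simp_all
    ultimately show "(\<Prod>q\<in>S. - of_bool (q dvd k)) = (- 1) ^ card S * (of_bool (\<Prod>S dvd k) :: 'a)"
      by simp
  qed
  finally show ?thesis .
qed

lemma prod_subset_prime_factors_dvd:
  fixes n :: nat
  assumes "n > 0" "S \<subseteq> prime_factors n"
  shows "\<Prod>S dvd n"
proof -
  have "\<Prod>S dvd \<Prod>(prime_factors n)"
    using assms by (intro prod_dvd_prod_subset) auto
  also have "\<Prod>(prime_factors n) dvd (\<Prod>q\<in>prime_factors n. q ^ multiplicity q n)"
    by (intro prod_dvd_prod) (auto simp: prime_factors_multiplicity intro: dvd_power)
  also have "\<dots> = n"
    using assms by (simp add: prod_prime_factors)
  finally show ?thesis .
qed

section \<open>Discrete logarithms to a primitive root and the characters they define\<close>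

definition mod_index :: "nat \<Rightarrow> nat \<Rightarrow> int \<Rightarrow> nat" where
  "mod_index p g x = (THE k. k < p - 1 \<and> [int g ^ k = x] (mod int p))"

text \<open>The \<open>j\<close>-th power of the character that sends the primitive root
  \<open>g\<close> to exp(2 pi i / (p - 1)).\<close>

definition index_character :: "nat \<Rightarrow> nat \<Rightarrow> nat \<Rightarrow> int \<Rightarrow> complex" where
  "index_character p g j x =
     (if int p dvd x then 0 else cis (2 * pi * real j * real (mod_index p g x) / real (p - 1)))"

text \<open>Reduction modulo \<open>p\<close> makes the indicator periodic on all integers, so that
  it can be shifted and compared with characters.\<close>

definition primroot_indicator :: "nat \<Rightarrow> int \<Rightarrow> real" where
  "primroot_indicator p x = of_bool (residue_primroot p (nat (x mod int p)))"

context
  fixes p g :: nat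
  assumes prime_p: "prime p" and g: "residue_primroot p g"
begin

lemma p_ge_2: "p \<ge> 2"
  using prime_p by (rule prime_ge_2_nat)

lemma coprime_p_g: "coprime p g" and ord_g: "ord p g = p - 1"
  using g prime_p by (simp_all add: residue_primroot_def totient_prime)

lemma power_g_cong_iff: "[int g ^ a = int g ^ b] (mod int p) \<longleftrightarrow> [a = b] (mod (p - 1))"
  using order_divides_expdiff[OF coprime_p_g, of a b] ord_g
  by (simp flip: of_nat_power add: cong_int_iff)

lemma ex1_mod_index:
  assumes "\<not> int p dvd x"
  shows "\<exists>!k. k < p - 1 \<and> [int g ^ k = x] (mod int p)"
proof -
  define y where "y = nat (x mod int p)"
  have y: "int y = x mod int p"
    using p_ge_2 by (simp add: y_def)
  have "\<not> p dvd y"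
    using assms y by (simp add: dvd_mod_iff flip: int_dvd_int_iff)
  moreover have "y < p"
    using p_ge_2 by (simp add: y_def nat_less_iff)
  ultimately have "y \<in> totatives p"
    using prime_p by (auto simp: totatives_prime intro!: Nat.gr0I)
  also have "totatives p = (\<lambda>i. g ^ i mod p) ` {..<p - 1}"
    using bij_betw_imp_surj_on[OF residue_primroot_is_generator[OF _ g]] p_ge_2 prime_p
    by (simp add: totient_prime)
  finally obtain k where k: "k < p - 1" "g ^ k mod p = y"
    by auto
  have "int (g ^ k mod p) = x mod int p"
    by (simp only: k(2) y)
  then have k': "[int g ^ k = x] (mod int p)"
    by (simp add: cong_def of_nat_mod)
  moreover have "l = k" if l: "l < p - 1" "[int g ^ l = x] (mod int p)" for l
  proof -
    have "[l = k] (mod (p - 1))"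
      using cong_trans[OF l(2) cong_sym[OF k']] by (simp only: power_g_cong_iff)
    then show ?thesis
      using l(1) k(1) by (simp add: cong_def)
  qed
  ultimately show ?thesis
    using k(1) by blast
qed

lemma mod_index_cong: "\<not> int p dvd x \<Longrightarrow> [int g ^ mod_index p g x = x] (mod int p)"
  unfolding mod_index_def using theI'[OF ex1_mod_index] by blast

lemma mod_index_mult:
  assumes "\<not> int p dvd x" "\<not> int p dvd y"
  shows "[mod_index p g (x * y) = mod_index p g x + mod_index p g y] (mod (p - 1))"
proof -
  have "\<not> int p dvd x * y"
    using assms prime_p by (simp add: prime_dvd_mult_iff)
  then have "[int g ^ mod_index p g (x * y) = x * y] (mod int p)"
    by (rule mod_index_cong)
  moreover have "[int g ^ (mod_index p g x + mod_index p g y) = x * y] (mod int p)"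
    using assms by (simp add: power_add cong_mult mod_index_cong)
  ultimately show ?thesis
    using power_g_cong_iff cong_sym cong_trans by blast
qed

lemma index_character_mod_character: "mod_character (int p) (index_character p g j)"
  unfolding mod_character_def
proof (intro conjI allI)
  fix x y
  show "index_character p g j (x mod int p) = index_character p g j x"
    by (simp add: index_character_def mod_index_def cong_def dvd_mod_iff)
  show "norm (index_character p g j x) = (if int p dvd x then 0 else 1)"
    by (simp add: index_character_def)
  show "index_character p g j (x * y) = index_character p g j x * index_character p g j y"
  proof (cases "int p dvd x \<or> int p dvd y")
    case True
    then show ?thesis
      by (auto simp: index_character_def)
  next
    case False
    then have "\<not> int p dvd x * y"
      using prime_p by (simp add: prime_dvd_mult_iff)
    moreover have "cis (2 * pi * real j * real (mod_index p g (x * y)) / real (p - 1)) =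
        cis (2 * pi * real j * real (mod_index p g x + mod_index p g y) / real (p - 1))"
      using False p_ge_2 by (intro cis_cong mod_index_mult) auto
    ultimately show ?thesis
      using False by (simp add: index_character_def cis_mult distrib_left add_divide_distrib)
  qed
qed

text \<open>The order of g^k is (p - 1) / gcd(k, p - 1).\<close>

lemma primroot_iff_coprime_index:
  assumes "\<not> int p dvd x"
  shows "residue_primroot p (nat (x mod int p)) \<longleftrightarrow> coprime (mod_index p g x) (p - 1)"
proof -
  define k where "k = mod_index p g x"
  have "[int g ^ k = x] (mod int p)"
    unfolding k_def by (rule mod_index_cong[OF assms])
  then have "int (g ^ k mod p) = x mod int p"
    by (simp add: cong_def of_nat_mod)
  then have "nat (x mod int p) = g ^ k mod p"
    by (metis nat_int)
  then have "residue_primroot p (nat (x mod int p)) \<longleftrightarrow> ord p (g ^ k) = p - 1"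
    using prime_p p_ge_2 coprime_p_g by (simp add: residue_primroot_def totient_prime)
  also have "\<dots> \<longleftrightarrow> gcd k (p - 1) = 1"
    using ord_power_aux[of p g k] ord_g p_ge_2 by auto
  finally show ?thesis
    unfolding k_def coprime_iff_gcd_eq_1 .
qed

text \<open>Being a primitive root means coprimality of the index to p - 1. Inclusion-exclusion
  reduces this to the conditions that \<open>\<Prod>S\<close> divides the index, and each of these
  is detected by averaging the characters of order dividing \<open>\<Prod>S\<close>, which are those
  with index a multiple of (p - 1) / \<open>\<Prod>S\<close>.\<close>

lemma primroot_indicator_expansion:
  defines "I \<equiv> Sigma (Pow (prime_factors (p - 1))) (\<lambda>S. {..<\<Prod>S})"
  shows "complex_of_real (primroot_indicator p x) =
    (\<Sum>(S, i)\<in>I. (- 1) ^ card S / of_nat (\<Prod>S) * index_character p g (i * ((p - 1) div \<Prod>S)) x)"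
proof (cases "int p dvd x")
  case True
  then show ?thesis
    using p_ge_2 by (simp add: primroot_indicator_def index_character_def split_def)
next
  case False
  let ?n = "p - 1" and ?k = "mod_index p g x"
  have n0: "?n > 0"
    using p_ge_2 by simp
  have "complex_of_real (primroot_indicator p x) = of_bool (coprime ?k ?n)"
    using primroot_iff_coprime_index[OF False] by (simp add: primroot_indicator_def)
  also have "\<dots> = (\<Sum>S\<in>Pow (prime_factors ?n). (- 1) ^ card S * of_bool (\<Prod>S dvd ?k))"
    by (rule of_bool_coprime_eq_sum[OF n0])
  also have "\<dots> = (\<Sum>S\<in>Pow (prime_factors ?n). \<Sum>i<\<Prod>S.
      (- 1) ^ card S / of_nat (\<Prod>S) * index_character p g (i * (?n div \<Prod>S)) x)"
  proof (intro sum.cong refl)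
    fix S assume "S \<in> Pow (prime_factors ?n)"
    then have dvd: "\<Prod>S dvd ?n"
      using prod_subset_prime_factors_dvd[OF n0] by simp
    then have pos: "\<Prod>S > 0"
      using n0 by (metis dvd_0_left_iff gr0I)
    have "index_character p g (i * (?n div \<Prod>S)) x = cis (2 * pi * real i * real ?k / real (\<Prod>S))" for i
    proof -
      obtain m where m: "?n = \<Prod>S * m"
        using dvd by blast
      then have "m > 0"
        using n0 by (metis gr0I mult_0_right)
      then have "2 * pi * real (i * (?n div \<Prod>S)) * real ?k / real ?n = 2 * pi * real i * real ?k / real (\<Prod>S)"
        unfolding m using pos by (simp add: field_simps)
      then show ?thesis
        using False by (simp only: index_character_def if_False)
    qed
    then show "(- 1) ^ card S * of_bool (\<Prod>S dvd ?k) =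
        (\<Sum>i<\<Prod>S. (- 1) ^ card S / of_nat (\<Prod>S) * index_character p g (i * (?n div \<Prod>S)) x)"
      unfolding of_bool_dvd_eq_sum_cis[OF pos] by (simp add: sum_distrib_left sum_divide_distrib)
  qed
  also have "\<dots> = (\<Sum>(S, i)\<in>I. (- 1) ^ card S / of_nat (\<Prod>S) * index_character p g (i * (?n div \<Prod>S)) x)"
    unfolding I_def by (subst sum.Sigma) (auto intro: finite_subset)
  finally show ?thesis .
qed

end

section \<open>Counting and correlating primitive roots\<close>

lemma sum_primroot_indicator:
  assumes "prime p" "p > 2"
  shows "(\<Sum>x\<in>{0..<int p}. primroot_indicator p x) = totient (p - 1)"
proof -
  have "(\<Sum>x\<in>{0..<int p}. primroot_indicator p x) = (\<Sum>x<p. of_bool (residue_primroot p x))"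
    by (rule sum.reindex_bij_witness[of _ int nat])
       (auto simp: primroot_indicator_def nat_less_iff)
  also have "\<dots> = card {x\<in>{..<p}. residue_primroot p x}"
    by (simp add: of_bool_def sum.If_cases Int_def)
  also have "residue_primroot p = (\<lambda>x. ord p x = p - 1)"
  proof
    fix x
    \<comment> \<open>The order of a number not coprime to \<open>p\<close> is 0 by convention, and
      p - 1 is positive.\<close>
    have "coprime p x" if "ord p x = p - 1"
      using that assms(2) ord_gt_0_iff[of p x] by linarith
    then show "residue_primroot p x = (ord p x = p - 1)"
      using assms by (auto simp: residue_primroot_def totient_prime)
  qed
  finally show ?thesis
    using prime_card_primitive_roots(2)[OF _ assms(1)] assms(2) by simp
qed

lemma primroot_correlation:
  assumes "prime p" "p > 2" and h: "\<not> int p dvd h"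
  shows "\<bar>(\<Sum>x\<in>{0..<int p}. primroot_indicator p x * primroot_indicator p (x + h)) -
           (real (totient (p - 1)) / real (p - 1))\<^sup>2 * (real p - 2)\<bar>
         \<le> (2 ^ card (prime_factors (p - 1)))\<^sup>2 * sqrt p"
proof -
  obtain g where g: "residue_primroot p g"
    using prime_primitive_root_exists[OF _ assms(1)] assms(2) by auto
  define n where "n = p - 1"
  define I where "I = Sigma (Pow (prime_factors n)) (\<lambda>S. {..<\<Prod>S})"
  define a where "a = (\<lambda>(S :: nat set, i :: nat). (- 1) ^ card S / of_nat (\<Prod>S) :: complex)"
  define \<chi> where "\<chi> = (\<lambda>(S, i). index_character p g (i * (n div \<Prod>S)))"
  define b where "b = (\<Sum>\<alpha> | \<alpha> \<in> I \<and> \<chi> \<alpha> = principal_character (int p). a \<alpha>)"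
  have finI: "finite I"
    unfolding I_def by (auto intro: finite_subset)
  have \<chi>: "mod_character (int p) (\<chi> \<alpha>)" for \<alpha>
    by (simp add: \<chi>_def split_def index_character_mod_character[OF assms(1) g])
  have F: "complex_of_real (primroot_indicator p x) = (\<Sum>\<alpha>\<in>I. a \<alpha> * \<chi> \<alpha> x)" for x
    using primroot_indicator_expansion[OF assms(1) g, of x]
    unfolding a_def \<chi>_def I_def n_def case_prod_beta .
  have p: "prime (int p)"
    using assms by simp
  \<comment> \<open>The known number of primitive roots determines \<open>b\<close>; there is no
    need to identify the pairs in \<open>I\<close> that yield the principal character.\<close>
  have "complex_of_real (totient n) = (\<Sum>x\<in>{0..<int p}. complex_of_real (primroot_indicator p x))"
    unfolding n_def by (simp only: of_real_sum[symmetric] sum_primroot_indicator[OF assms(1,2)])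
  also have "\<dots> = b * (of_int (int p) - 1)"
    unfolding b_def by (rule character_combination_sum[OF p finI \<chi> F])
  finally have "complex_of_real (totient n) = b * (of_nat p - 1)"
    by simp
  moreover have "of_nat p - 1 = complex_of_real (real n)" "n > 0"
    using assms(2) by (simp_all add: n_def of_nat_diff)
  ultimately have b: "b = complex_of_real (totient n / n)"
    by simp
  \<comment> \<open>Each \<open>S\<close> carries \<open>\<Prod>S\<close> coefficients of modulus 1
    / \<open>\<Prod>S\<close>, hence total weight 1.\<close>
  have norm_a: "(\<Sum>\<alpha>\<in>I. norm (a \<alpha>)) = 2 ^ card (prime_factors n)"
  proof -
    have na: "norm (a (S, i)) = 1 / real (\<Prod>S)" for S i
      unfolding a_def prod.case
      by (simp only: norm_divide norm_power norm_minus_cancel norm_one power_one norm_of_nat)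
    have "(\<Sum>\<alpha>\<in>I. norm (a \<alpha>)) = (\<Sum>S\<in>Pow (prime_factors n). \<Sum>i<\<Prod>S. norm (a (S, i)))"
      unfolding I_def by (subst sum.Sigma) auto
    also have "\<dots> = (\<Sum>S\<in>Pow (prime_factors n). 1)"
    proof (intro sum.cong refl)
      fix S assume "S \<in> Pow (prime_factors n)"
      then have "\<Prod>S dvd n"
        using prod_subset_prime_factors_dvd[OF \<open>n > 0\<close>] by blast
      then have "\<Prod>S \<noteq> 0"
        using \<open>n > 0\<close> by (intro notI) (simp only: dvd_0_left_iff less_irrefl)
      then have "real (\<Prod>S) \<noteq> 0"
        by (simp only: of_nat_eq_0_iff not_False_eq_True)
      then show "(\<Sum>i<\<Prod>S. norm (a (S, i))) = 1"
        unfolding na sum_constant card_lessThan by (simp only: times_divide_eq_right mult_1_right divide_self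
            not_False_eq_True)
    qed
    also have "\<dots> = 2 ^ card (prime_factors n)"
      by (simp add: card_Pow)
    finally show ?thesis .
  qed
  have "complex_of_real ((\<Sum>x\<in>{0..<int p}. primroot_indicator p x * primroot_indicator p (x + h)) -
           (real (totient n) / real n)\<^sup>2 * (real p - 2)) =
      (\<Sum>x\<in>{0..<int p}. complex_of_real (primroot_indicator p x) * complex_of_real (primroot_indicator p (x + h))) -
      b\<^sup>2 * (of_int (int p) - 2)"
    by (simp only: b of_real_diff of_real_mult of_real_sum of_real_power of_int_of_nat_eq
        of_real_of_nat_eq of_real_numeral)
  also have "norm \<dots> \<le> (2 ^ card (prime_factors n))\<^sup>2 * sqrt p"
    using character_combination_correlation[OF p finI \<chi> F h]
    unfolding b_def[symmetric] norm_a of_int_of_nat_eq .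
  finally show ?thesis
    by (simp only: norm_of_real n_def)
qed

subsection \<open>Alternating sums over short windows\<close>

lemma power_card_prime_factors_le:
  fixes k n :: nat
  assumes "n > 0" "k > 0"
  shows "k ^ card (prime_factors n) \<le> k ^ k * n"
proof -
  let ?P = "prime_factors n"
  have P: "q > 0" if "q \<in> ?P" for q
    using that by (auto simp: in_prime_factors_iff prime_gt_0_nat)
  have "k ^ card ?P = (\<Prod>q\<in>?P. k)"
    by simp
  \<comment> \<open>A prime \<open>q \<ge> k\<close> pays for its factor \<open>k\<close> by itself;
    only the at most \<open>k\<close> primes below \<open>k\<close> need an extra factor
    \<open>k\<close>.\<close>
  also have "\<dots> \<le> (\<Prod>q\<in>?P. (if q < k then k else 1) * q)"
    by (intro prod_mono) (use P in \<open>auto simp: Suc_le_eq\<close>)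
  also have "\<dots> = (\<Prod>q\<in>?P. if q < k then k else 1) * \<Prod>?P"
    by (rule prod.distrib)
  also have "(\<Prod>q\<in>?P. if q < k then k else 1) = k ^ card {q\<in>?P. q < k}"
    by (simp add: prod.inter_filter[symmetric])
  also have "\<dots> \<le> k ^ k"
    using assms(2) card_mono[of "{..<k}" "{q\<in>?P. q < k}"] by (intro power_increasing) auto
  also have "\<Prod>?P \<le> n"
    using assms(1) by (intro dvd_imp_le prod_subset_prime_factors_dvd) auto
  finally show ?thesis
    by (simp add: mult_le_mono)
qed

text \<open>Every factor 1 - 1/q of the Euler product is at least 1/2.\<close>

lemma totient_ratio_ge:
  assumes "n > 0"
  shows "real (totient n) / real n \<ge> 1 / 2 ^ card (prime_factors n)"
proof -
  have "(1 / 2) ^ card (prime_factors n) = (\<Prod>q\<in>prime_factors n. 1 / 2 :: real)"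
    by simp
  also have "\<dots> \<le> (\<Prod>q\<in>prime_factors n. 1 - 1 / real q)"
  proof (intro prod_mono conjI)
    fix q assume "q \<in> prime_factors n"
    then have "q \<ge> 2"
      by (auto simp: in_prime_factors_iff intro: prime_ge_2_nat)
    then show "1 / 2 \<le> 1 - 1 / real q"
      by (simp add: field_simps)
  qed simp
  finally show ?thesis
    using assms by (simp add: totient_formula2 power_one_over)
qed

text \<open>The prime 2 contributes the factor 1/2 to the Euler product, and the other factors are
  at most 1.\<close>

lemma totient_ratio_le:
  assumes "n > 0" "even n"
  shows "real (totient n) / real n \<le> 1 / 2"
proof -
  have "2 \<in> prime_factors n"
    using assms by (simp add: in_prime_factors_iff)
  then have "(\<Prod>q\<in>prime_factors n. 1 - 1 / real q) =
      (1 - 1 / real 2) * (\<Prod>q\<in>prime_factors n - {2}. 1 - 1 / real q)"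
    by (intro prod.remove) auto
  also have "\<dots> \<le> (1 - 1 / real 2) * 1"
    by (intro mult_left_mono prod_le_1)
       (auto simp: in_prime_factors_iff field_simps prime_gt_0_nat Suc_le_eq)
  finally show ?thesis
    using assms by (simp add: totient_formula2)
qed

text \<open>The second moment of the window sums is estimated twice. From below, the correlations
  leave L (C 0 - m) from the diagonal, a nonnegative multiple of \<open>m\<close>, and an error of
  at most L^2 E. From above, a window inside one period contributes at most 1 by hypothesis.\<close>

lemma alternating_window_second_moment:
  fixes f :: "int \<Rightarrow> real" and p :: int and L :: nat
  assumes p: "p > 0" and per: "\<And>x. f (x mod p) = f x" and f01: "\<And>x. 0 \<le> f x \<and> f x \<le> 1"
    and corr: "\<And>h. h \<noteq> 0 \<Longrightarrow> \<bar>h\<bar> < int L \<Longrightarrow>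
      \<bar>(\<Sum>x\<in>{0..<p}. f x * f (x + h)) - m\<bar> \<le> E"
    and m: "m \<ge> 0" and E: "E \<ge> 0"
    and window: "\<And>w. 0 \<le> w \<Longrightarrow> w + int L \<le> p \<Longrightarrow> \<bar>\<Sum>i<L. (- 1) ^ i * f (w + int i)\<bar> \<le> 1"
  shows "real L * ((\<Sum>x\<in>{0..<p}. f x * f x) - m) \<le> of_int p + real L ^ 3 + (real L)\<^sup>2 * E"
proof -
  define C where "C h = (\<Sum>x\<in>{0..<p}. f x * f (x + h))" for h
  define Z where "Z w = (\<Sum>i<L. (- 1) ^ i * f (w + int i))" for w
  \<comment> \<open>The deviation from the main term: it vanishes for \<open>i = j\<close>, and off
    the diagonal it is a correlation error up to sign.\<close>
  define e where "e i j = (- 1) ^ (i + j) * (C (int j - int i) - m) -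
    (if i = j then C 0 - m else 0)" for i j :: nat
  have shift: "(\<Sum>w\<in>{0..<p}. f (w + i) * f (w + j)) = C (j - i)" for i j
  proof -
    have "(\<Sum>w\<in>{0..<p}. f (w + i) * f (w + j)) = (\<Sum>w\<in>{0..<p}. f (w + i) * f ((w + i) + (j - i)))"
      by simp
    also have "\<dots> = C (j - i)"
      unfolding C_def using per
      by (intro sum_residues_shift p) (metis mod_add_left_eq)
    finally show ?thesis .
  qed
  have "(\<Sum>w\<in>{0..<p}. (Z w)\<^sup>2) = (\<Sum>w\<in>{0..<p}. \<Sum>i<L. \<Sum>j<L.
      (- 1) ^ (i + j) * (f (w + int i) * f (w + int j)))"
    by (simp add: Z_def power2_eq_square sum_product power_add ac_simps)
  also have "\<dots> = (\<Sum>i<L. \<Sum>j<L. \<Sum>w\<in>{0..<p}.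
      (- 1) ^ (i + j) * (f (w + int i) * f (w + int j)))"
    by (subst sum.swap, rule sum.cong[OF refl], subst sum.swap) (rule refl)
  also have "\<dots> = (\<Sum>i<L. \<Sum>j<L. (- 1) ^ (i + j) * C (int j - int i))"
    by (simp only: sum_distrib_left[symmetric] shift)
  also have "\<dots> = (\<Sum>i<L. \<Sum>j<L. m * ((- 1) ^ i * (- 1) ^ j) + (if i = j then C 0 - m else 0) + e i j)"
    by (intro sum.cong refl) (simp add: e_def power_add algebra_simps)
  also have "\<dots> = m * (\<Sum>i<L. (- 1) ^ i)\<^sup>2 + real L * (C 0 - m) + (\<Sum>i<L. \<Sum>j<L. e i j)"
    unfolding power2_eq_square sum_product by (simp add: sum.distrib flip: sum_distrib_left)
  also have "\<dots> \<ge> 0 + real L * (C 0 - m) + - ((real L)\<^sup>2 * E)"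
  proof (intro add_mono order_refl)
    have "\<bar>e i j\<bar> \<le> E" if "i < L" "j < L" for i j
      using corr[of "int j - int i"] that E by (auto simp: e_def C_def abs_mult)
    then have "\<bar>\<Sum>i<L. \<Sum>j<L. e i j\<bar> \<le> (\<Sum>i<L. \<Sum>j<L. E)"
      by (intro order_trans[OF sum_abs] sum_mono) auto
    then show "- ((real L)\<^sup>2 * E) \<le> (\<Sum>i<L. \<Sum>j<L. e i j)"
      by (simp add: power2_eq_square)
  qed (use m in auto)
  finally have lower: "real L * (C 0 - m) - (real L)\<^sup>2 * E \<le> (\<Sum>w\<in>{0..<p}. (Z w)\<^sup>2)"
    by simp
  \<comment> \<open>Windows running past \<open>p\<close> are not covered by the hypothesis. They
    start among the last \<open>L\<close> residues and get the trivial bound L^2, for a total of at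
    most L^3.\<close>
  have "(\<Sum>w\<in>{0..<p}. (Z w)\<^sup>2) \<le> (\<Sum>w\<in>{0..<p}. 1 + (if w \<in> {p - int L..<p} then (real L)\<^sup>2 else 0))"
  proof (intro sum_mono)
    fix w assume w: "w \<in> {0..<p}"
    show "(Z w)\<^sup>2 \<le> 1 + (if w \<in> {p - int L..<p} then (real L)\<^sup>2 else 0)"
    proof (cases "w + int L \<le> p")
      case True
      then have "(Z w)\<^sup>2 \<le> 1"
        using window[of w] w by (simp add: Z_def abs_square_le_1)
      then show ?thesis
        by (intro add_increasing2) auto
    next
      case False
      have "\<bar>Z w\<bar> \<le> (\<Sum>i<L. 1)"
        unfolding Z_def using f01 by (intro order_trans[OF sum_abs] sum_mono) (simp add: abs_mult)
      then have "(Z w)\<^sup>2 \<le> (real L)\<^sup>2"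
        by (intro power2_le_iff_abs_le[THEN iffD2]) auto
      moreover have "w \<in> {p - int L..<p}"
        using False w by simp
      ultimately show ?thesis
        by simp
    qed
  qed
  also have "\<dots> = of_int p + (\<Sum>w\<in>{0..<p} \<inter> {p - int L..<p}. (real L)\<^sup>2)"
    by (subst sum.inter_restrict) (use p in \<open>simp_all add: sum.distrib\<close>)
  also have "(\<Sum>w\<in>{0..<p} \<inter> {p - int L..<p}. (real L)\<^sup>2) \<le> (\<Sum>w\<in>{p - int L..<p}. (real L)\<^sup>2)"
    by (intro sum_mono2) auto
  also have "\<dots> = real L ^ 3"
    by (simp add: power2_eq_square power3_eq_cube)
  finally show ?thesis
    using lower by (simp add: C_def)
qed

section \<open>The increasing enumeration of the primitive roots\<close>

lemma residue_primroot_bounds: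
  assumes "prime p" "p > 3" "x < p" "residue_primroot p x"
  shows "1 < x" "x < p - 1"
proof -
  have ord: "ord p x = p - 1"
    using assms by (simp add: residue_primroot_def totient_prime)
  have "x \<noteq> 0" "x \<noteq> 1"
    using assms by (auto simp: residue_primroot_1_iff intro!: Nat.gr0I)
  then show "1 < x"
    by simp
  \<comment> \<open>The residue - 1 has order dividing 2, which is too small as p - 1 > 2.\<close>
  have "x \<noteq> p - 1"
  proof
    assume "x = p - 1"
    then have "int x = int p - 1"
      using assms by (simp add: of_nat_diff)
    then have "int x ^ 2 - 1 = int p * (int p - 2)"
      by (simp only:) (simp add: power2_eq_square algebra_simps)
    then have "[int (x ^ 2) = int 1] (mod int p)"
      by (simp add: cong_iff_dvd_diff)
    then have "[x ^ 2 = 1] (mod p)"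
      by (simp only: cong_int_iff)
    then have "p - 1 dvd 2"
      by (simp only: ord_divides ord)
    then show False
      using assms(2) by (auto dest: dvd_imp_le)
  qed
  then show "x < p - 1"
    using assms by simp
qed

lemma strict_mono_on_initial_segment:
  fixes g :: "nat \<Rightarrow> nat"
  assumes "strict_mono_on {1..N} g"
  obtains k where "{i \<in> {1..N}. g i < y} = {1..k}"
proof -
  define A where "A = {i \<in> {1..N}. g i < y}"
  \<comment> \<open>Inserting 0 covers the case of empty \<open>A\<close>, where
    \<open>{1..k}\<close> is then empty as well.\<close>
  define k where "k = Max (insert 0 A)"
  have fin: "finite A"
    by (simp add: A_def)
  have "A = {1..k}"
  proof (intro equalityI subsetI)
    fix i assume "i \<in> A"
    then show "i \<in> {1..k}"
      using fin by (auto simp: A_def k_def)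
  next
    fix i assume i: "i \<in> {1..k}"
    have "k \<in> insert 0 A"
      unfolding k_def using fin by (intro Max_in) auto
    with i have "k \<in> A"
      by auto
    then have k: "k \<in> {1..N}" "g k < y"
      by (simp_all add: A_def)
    then have "i \<in> {1..N}"
      using i by simp
    then have "g i \<le> g k"
      using i k by (intro strict_mono_on_leD[OF assms]) auto
    then show "i \<in> A"
      using \<open>i \<in> {1..N}\<close> k by (simp add: A_def)
  qed
  then show ?thesis
    using that unfolding A_def by blast
qed

text \<open>The signs attached to successive members of the enumeration alternate, so every partial
  sum \<open>H y\<close> is either 0 or the first sign. Up to sign, a window sum is a difference of
  two partial sums.\<close>

lemma alternating_enumeration_window:
  fixes g :: "nat \<Rightarrow> nat"
  assumes mono: "strict_mono_on {1..N} g"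
    and alt: "\<And>i. 1 \<le> i \<Longrightarrow> i < N \<Longrightarrow> odd (g i + g (i + 1))"
  shows "\<bar>\<Sum>i<L. (- 1) ^ i * of_bool (w + i \<in> g ` {1..N})\<bar> \<le> (1 :: real)"
proof -
  define H :: "nat \<Rightarrow> real" where "H y = (\<Sum>x<y. (- 1) ^ x * of_bool (x \<in> g ` {1..N}))" for y
  have sgn: "(- 1) ^ g i = (- 1 :: real) ^ (g 1 + i + 1)" if "1 \<le> i" "i \<le> N" for i
    using that
  proof (induction i rule: nat_induct_at_least)
    case (Suc i)
    then have "(- 1) ^ (g i + g (i + 1)) = (- 1 :: real)"
      using alt by simp
    then have "(- 1) ^ g (Suc i) = - ((- 1 :: real) ^ g i)"
      by (auto simp: power_add minus_one_power_iff split: if_splits)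
    then show ?case
      using Suc by (simp add: power_add)
  qed simp
  have H: "H y = 0 \<or> H y = (- 1) ^ g 1" for y
  proof -
    obtain k where k: "{i \<in> {1..N}. g i < y} = {1..k}"
      using strict_mono_on_initial_segment[OF mono] by blast
    have inj: "inj_on g {1..k}"
      using strict_mono_on_imp_inj_on[OF mono] unfolding k[symmetric] by (rule inj_on_subset) auto
    have "H y = (\<Sum>x\<in>g ` {1..k}. (- 1) ^ x)"
      unfolding H_def k[symmetric] by (intro sum.mono_neutral_cong_right) auto
    also have "\<dots> = (\<Sum>i\<in>{1..k}. (- 1) ^ g i)"
      using inj by (simp add: sum.reindex)
    also have "\<dots> = (\<Sum>i\<in>{1..k}. (- 1) ^ (g 1 + i + 1))"
    proof (intro sum.cong refl sgn)
      fix i assume "i \<in> {1..k}"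
      then show "1 \<le> i" "i \<le> N"
        unfolding k[symmetric] by simp_all
    qed
    also have "\<dots> = (if even k then 0 else (- 1) ^ g 1)"
      by (induction k) (auto simp: power_add)
    finally show ?thesis
      by auto
  qed
  have "H (w + L) = H w + (\<Sum>i<L. (- 1) ^ (w + i) * of_bool (w + i \<in> g ` {1..N}))"
    unfolding H_def by (induction L) auto
  then have "(- 1) ^ w * (\<Sum>i<L. (- 1) ^ i * of_bool (w + i \<in> g ` {1..N})) = H (w + L) - H w"
    by (simp only: sum_distrib_left power_add mult.assoc add_diff_cancel_left')
  then have "\<bar>\<Sum>i<L. (- 1) ^ i * of_bool (w + i \<in> g ` {1..N})\<bar> = \<bar>H (w + L) - H w\<bar>"
    by (simp add: abs_mult power_abs flip: \<open>_ = H (w + L) - H w\<close>)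
  also have "\<dots> \<le> 1"
    using H[of w] H[of "w + L"] by (auto simp: power_abs)
  finally show ?thesis .
qed

text \<open>With D = 2^\<omega>(p - 1), failure would give p \<le> 200^2 D^8, whereas D^9 =
  512^\<omega>(p - 1) is at most a constant times p. Exponent 9 beating 8 bounds D, and with it
  p.\<close>

lemma omega_bound_eventually:
  "\<exists>p0. \<forall>p\<ge>p0. 200 * (2 ^ card (prime_factors (p - 1))) ^ 4 * sqrt (real p) < real p"
proof -
  obtain K :: nat where K: "512 ^ card (prime_factors n) \<le> K * n" if "n > 0" for n
    using power_card_prime_factors_le[of _ 512] by (metis zero_less_numeral)
  \<comment> \<open>Combining D^9 \<le> K p with p \<le> 40000 D^8 gives D \<le> 40000 K; inserting
    this into the second bound yields \<open>p0\<close>.\<close>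
  define p0 where "p0 = 40000 * (40000 * real K) ^ 8"
  have "200 * (2 ^ card (prime_factors (p - 1))) ^ 4 * sqrt (real p) < real p"
    if p: "p \<ge> 2 + nat \<lceil>p0\<rceil>" for p
  proof (rule ccontr)
    define D where "D = (2 :: real) ^ card (prime_factors (p - 1))"
    have D: "D \<ge> 1"
      by (simp add: D_def)
    assume "\<not> ?thesis"
    then have "real p \<le> 200 * D ^ 4 * sqrt (real p)"
      by (simp add: D_def)
    then have "(real p)\<^sup>2 \<le> (200 * D ^ 4 * sqrt (real p))\<^sup>2"
      by (intro power_mono) auto
    also have "\<dots> = (40000 * D ^ 8) * real p"
      by (simp add: power_mult_distrib flip: power_mult)
    finally have *: "real p \<le> 40000 * D ^ 8"
      using p by (simp add: power2_eq_square)
    have "D * D ^ 8 = D ^ 9"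
      by (simp flip: power_Suc)
    also have "\<dots> = (2 ^ 9) ^ card (prime_factors (p - 1))"
      unfolding D_def by (metis power_mult mult.commute)
    also have "(2 :: real) ^ 9 = 512"
      by simp
    finally have "D * D ^ 8 = 512 ^ card (prime_factors (p - 1))" .
    also have "\<dots> = real (512 ^ card (prime_factors (p - 1)))"
      by simp
    also have "\<dots> \<le> real (K * (p - 1))"
      using p by (intro of_nat_mono K) simp
    also have "\<dots> \<le> real K * real p"
      by (simp add: mult_left_mono)
    also have "\<dots> \<le> real K * (40000 * D ^ 8)"
      by (intro mult_left_mono *) simp
    finally have "D \<le> 40000 * real K"
      using D by simp
    then have "D ^ 8 \<le> (40000 * real K) ^ 8"
      using D by (intro power_mono) auto
    with * have "real p \<le> p0"
      unfolding p0_def by linarith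
    then show False
      using p by linarith
  qed
  then show ?thesis
    by blast
qed

subsection \<open>Parities of consecutive primitive roots\<close>

text \<open>Two adjacent residues that are both primitive roots break constant parity; alternating
  parity is refuted by the second moment of the window sums.\<close>

lemma primroot_parity_patterns:
  assumes p: "prime p" "p > 3"
    and large: "200 * (2 ^ card (prime_factors (p - 1))) ^ 4 * sqrt (real p) < real p"
    and enum: "primroot_enumeration p g"
  shows "\<exists>i. 1 \<le> i \<and> i < totient (p - 1) \<and> odd (g i + g (i + 1))"
    and "\<exists>i. 1 \<le> i \<and> i < totient (p - 1) \<and> even (g i + g (i + 1))"
proof -
  define n where "n = p - 1"
  define N where "N = totient n"
  define d where "d = (2 :: nat) ^ card (prime_factors n)"
  define D where "D = real d"
  define \<delta> where "\<delta> = real N / real n"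
  define f where "f = primroot_indicator p"
  have n: "n > 0" "real n = real p - 1"
    using p by (simp_all add: n_def)
  have "odd p"
    using p prime_odd_nat by simp
  then have "even n"
    using p by (simp add: n_def)
  have D: "D \<ge> 1" "D = 2 ^ card (prime_factors n)"
    by (simp_all add: D_def d_def)
  have large': "200 * (D ^ 4 * sqrt (real p)) < real p"
    using large by (simp add: D(2) n_def)
  have \<delta>: "1 / D \<le> \<delta>" "\<delta> \<le> 1 / 2" "0 \<le> \<delta>"
    using totient_ratio_ge[OF n(1)] totient_ratio_le[OF n(1) \<open>even n\<close>]
    by (simp_all add: \<delta>_def N_def D(2))
  have N_eq: "real N = \<delta> * (real p - 1)"
    using n by (simp add: \<delta>_def)
  have mono: "strict_mono_on {1..N} g"
    and range: "g ` {1..N} = {x. 1 < x \<and> x < p - 1 \<and> residue_primroot p x}"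
    using enum by (simp_all add: primroot_enumeration_def N_def n_def)
  have f_eq: "f (int x) = of_bool (x \<in> g ` {1..N})" if "x < p" for x
  proof -
    have "x \<in> g ` {1..N} \<longleftrightarrow> residue_primroot p x"
      unfolding range using residue_primroot_bounds[OF p that] by blast
    moreover have "nat (int x mod int p) = x"
      using that by simp
    ultimately show ?thesis
      by (simp only: f_def primroot_indicator_def)
  qed
  have f_per: "f (x mod int p) = f x" for x
    by (simp add: f_def primroot_indicator_def)
  have f01: "0 \<le> f x \<and> f x \<le> 1" for x
    by (simp add: f_def primroot_indicator_def)
  have corr: "\<bar>(\<Sum>x\<in>{0..<int p}. f x * f (x + h)) - \<delta>\<^sup>2 * (real p - 2)\<bar> \<le> D\<^sup>2 * sqrt p"
    if "\<not> int p dvd h" for h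
    using primroot_correlation[OF p(1) _ that] p(2)
    unfolding f_def \<delta>_def N_def n_def[symmetric] D(2) by simp

  show "\<exists>i. 1 \<le> i \<and> i < totient (p - 1) \<and> odd (g i + g (i + 1))"
  proof (rule ccontr)
    assume "\<not> ?thesis"
    then have ev: "even (g i + g (i + 1))" if "1 \<le> i" "i < N" for i
      using that by (auto simp: N_def n_def)
    have par: "even (g i) = even (g 1)" if "1 \<le> i" "i \<le> N" for i
      using that
    proof (induction i rule: nat_induct_at_least)
      case (Suc i)
      then show ?case
        using ev[of i] by simp
    qed simp
    have "f x * f (x + 1) = 0" if x: "x \<in> {0..<int p}" for x
    proof (rule ccontr)
      assume nz: "f x * f (x + 1) \<noteq> 0"
      define y where "y = nat x"
      have y: "x = int y" "y < p"
        using x by (auto simp: y_def)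
      then have "y \<in> g ` {1..N}"
        using nz f_eq[of y] by auto
      \<comment> \<open>Primitive roots stay below p - 1, so the successor does not wrap around to
        0.\<close>
      moreover from this have "y + 1 < p"
        unfolding range by auto
      then have "y + 1 \<in> g ` {1..N}"
        using nz f_eq[of "y + 1"] y by (auto simp: add.commute)
      ultimately obtain i j where "y = g i" "y + 1 = g j" "1 \<le> i" "i \<le> N" "1 \<le> j" "j \<le> N"
        by (auto simp only: image_iff atLeastAtMost_iff)
      then show False
        using par[of i] par[of j] by (metis even_plus_one_iff)
    qed
    then have "(\<Sum>x\<in>{0..<int p}. f x * f (x + 1)) = 0"
      by (intro sum.neutral) blast
    moreover have "\<not> int p dvd 1"
      using p by auto
    ultimately have "\<delta>\<^sup>2 * (real p - 2) \<le> D\<^sup>2 * sqrt p"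
      using corr[of 1] by (simp add: abs_le_iff)
    \<comment> \<open>Since \<open>\<delta>\<close> is at least 1/D, the vanishing correlation would
      force p - 2 \<le> D^4 sqrt p.\<close>
    moreover have "(1 / D)\<^sup>2 * (real p - 2) \<le> \<delta>\<^sup>2 * (real p - 2)"
      using p D \<delta> by (intro mult_right_mono power_mono) auto
    ultimately have "(1 / D)\<^sup>2 * (real p - 2) \<le> D\<^sup>2 * sqrt p"
      by linarith
    then have "D\<^sup>2 * ((1 / D)\<^sup>2 * (real p - 2)) \<le> D\<^sup>2 * (D\<^sup>2 * sqrt p)"
      using D by (intro mult_left_mono) auto
    moreover have "D\<^sup>2 * ((1 / D)\<^sup>2 * (real p - 2)) = real p - 2"
      using D(1) by (simp add: power_one_over)
    moreover have "D\<^sup>2 * (D\<^sup>2 * sqrt p) = D ^ 4 * sqrt p"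
      by (simp add: power2_eq_square power4_eq_xxxx)
    ultimately have "real p - 2 \<le> D ^ 4 * sqrt p"
      by simp
    then show False
      using large' p(2) by linarith
  qed

  show "\<exists>i. 1 \<le> i \<and> i < totient (p - 1) \<and> even (g i + g (i + 1))"
  proof (rule ccontr)
    assume "\<not> ?thesis"
    then have alt: "odd (g i + g (i + 1))" if "1 \<le> i" "i < N" for i
      using that by (auto simp: N_def n_def)
    \<comment> \<open>Chosen so that \<open>\<delta> * (1 - \<delta>) \<ge> 1 / (2 * D)\<close>
      gives a mean square of about 2 at least, against the bound 1 from alternation.\<close>
    define L where "L = 4 * d"
    have L: "real L = 4 * D"
      by (simp add: L_def D_def)
    have sqrt_p: "1 \<le> sqrt p"
      using p by simp
    have D4: "D ^ k \<le> D ^ 4 * sqrt p" if "k \<le> 4" for k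
    proof -
      have "D ^ k * 1 \<le> D ^ 4 * sqrt p"
        using D(1) that sqrt_p by (intro mult_mono power_increasing) auto
      then show ?thesis
        by simp
    qed
    \<comment> \<open>Hence no nonzero lag smaller than \<open>L\<close> in absolute value is a
      multiple of \<open>p\<close>, and all correlation estimates apply.\<close>
    have "real L \<le> real p"
      using L D4[of 1] large' by simp
    then have Lp: "L \<le> p"
      by simp
    have "(\<Sum>x\<in>{0..<int p}. f x * f x) = (\<Sum>x\<in>{0..<int p}. f x)"
      by (intro sum.cong refl) (simp add: f_def primroot_indicator_def)
    also have "\<dots> = real N"
      using sum_primroot_indicator[OF p(1)] p(2) by (simp add: f_def N_def n_def)
    finally have sum_f: "(\<Sum>x\<in>{0..<int p}. f x * f x) = real N" .
    have "real L * ((\<Sum>x\<in>{0..<int p}. f x * f x) - \<delta>\<^sup>2 * (real p - 2)) \<le>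
        of_int (int p) + real L ^ 3 + (real L)\<^sup>2 * (D\<^sup>2 * sqrt p)"
    proof (rule alternating_window_second_moment)
      fix h :: int assume "h \<noteq> 0" "\<bar>h\<bar> < int L"
      then have "\<not> int p dvd h"
        using Lp by (auto dest!: dvd_imp_le_int)
      then show "\<bar>(\<Sum>x\<in>{0..<int p}. f x * f (x + h)) - \<delta>\<^sup>2 * (real p - 2)\<bar> \<le> D\<^sup>2 * sqrt p"
        by (rule corr)
    next
      fix w :: int assume w: "0 \<le> w" "w + int L \<le> int p"
      define v where "v = nat w"
      have v: "w = int v" "v + L \<le> p"
        using w by (simp_all add: v_def)
      have "(\<Sum>i<L. (- 1) ^ i * f (w + int i)) = (\<Sum>i<L. (- 1) ^ i * of_bool (v + i \<in> g ` {1..N}))"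
        using v f_eq[of "v + _"] by (intro sum.cong refl) (simp flip: of_nat_add)
      then show "\<bar>\<Sum>i<L. (- 1) ^ i * f (w + int i)\<bar> \<le> 1"
        using alternating_enumeration_window[OF mono alt] by simp
    qed (use p f_per f01 in auto)
    then have "4 * D * (real N - \<delta>\<^sup>2 * (real p - 2)) \<le> real p + 64 * D ^ 3 + 16 * (D ^ 4 * sqrt p)"
      unfolding sum_f L by (simp add: power2_eq_square power3_eq_cube power4_eq_xxxx algebra_simps)
    \<comment> \<open>Here 80 = 64 + 16, since D^3 \<le> D^4 sqrt p.\<close>
    also have "\<dots> \<le> real p + 80 * (D ^ 4 * sqrt p)"
      using D4[of 3] by linarith
    finally have upper: "4 * D * (real N - \<delta>\<^sup>2 * (real p - 2)) \<le> real p + 80 * (D ^ 4 * sqrt p)" .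
    have "1 / D * (1 / 2) \<le> \<delta> * (1 - \<delta>)"
      using \<delta> D by (intro mult_mono) auto
    then have "1 / D * (1 / 2) * (real p - 1) \<le> \<delta> * (1 - \<delta>) * (real p - 1)"
      using p by (intro mult_right_mono) auto
    also have "\<dots> = real N - \<delta>\<^sup>2 * (real p - 1)"
      by (simp add: N_eq power2_eq_square algebra_simps)
    also have "\<dots> \<le> real N - \<delta>\<^sup>2 * (real p - 2)"
      by (intro diff_left_mono mult_left_mono) auto
    finally have lower: "1 / D * (1 / 2) * (real p - 1) \<le> real N - \<delta>\<^sup>2 * (real p - 2)" .
    have "2 * (real p - 1) = 4 * D * (1 / D * (1 / 2) * (real p - 1))"
      using D(1) by simp
    also have "\<dots> \<le> 4 * D * (real N - \<delta>\<^sup>2 * (real p - 2))"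
      using D(1) lower by (intro mult_left_mono) auto
    also note upper
    finally have "2 * (real p - 1) \<le> real p + 80 * (D ^ 4 * sqrt p)" .
    \<comment> \<open>The error is below 80 p / 200, so p - 2 < 2 p / 5, which fails from 4
      on.\<close>
    moreover have "real p \<ge> 4"
      using p(2) of_nat_mono[of 4 p, where 'a = real] by simp
    ultimately show False
      using large' by (smt (verit))
  qed
qed

section \<open>From a nonconstant period to the 2-adic complexity\<close>

lemma period_value_bounds:
  assumes s: "\<And>n. s n \<in> {0, 1}" and i: "i < T" "s i = 1" and j: "j < T" "s j = 0"
  shows "0 < period_value T s" "period_value T s < 2 ^ T - 1"
proof -
  have "s i * 2 ^ i \<le> period_value T s"
    unfolding period_value_def using i(1) by (intro member_le_sum) auto
  then show "0 < period_value T s"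
    using i(2) by (metis gr0I le_zero_eq mult_1 power_not_zero zero_neq_numeral)
  \<comment> \<open>The digit 0 at position \<open>j\<close> keeps the value below the all-ones
    number.\<close>
  have "period_value T s < (\<Sum>n<T. 2 ^ n)"
    unfolding period_value_def
  proof (intro sum_strict_mono_ex1 ballI bexI)
    fix n
    show "s n * 2 ^ n \<le> 2 ^ n"
      using s[of n] by auto
  qed (use j in auto)
  also have "(\<Sum>n<T. 2 ^ n) = 2 ^ T - (1 :: nat)"
    by (induction T) auto
  finally show "period_value T s < 2 ^ T - 1" .
qed

text \<open>The gcd is a proper divisor of 2^T - 1, so the quotient has a prime factor, which is at
  least the least prime divisor. If 2^T - 1 is prime, its only proper divisor is 1.\<close>

lemma two_adic_complexity_ge:
  assumes "0 < period_value T s" "period_value T s < 2 ^ T - 1"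
  shows "two_adic_complexity T s \<ge> \<lfloor>log 2 (real (LEAST r. prime r \<and> r dvd 2 ^ T - 1))\<rfloor>"
    and "prime (2 ^ T - 1 :: nat) \<Longrightarrow> two_adic_complexity T s = \<lfloor>log 2 (2 ^ T - 1)\<rfloor>"
proof -
  define M where "M = (2 :: nat) ^ T - 1"
  define d where "d = gcd M (period_value T s)"
  \<comment> \<open>Positivity is essential: the gcd with 0 would be \<open>M\<close>
    itself.\<close>
  have "d \<le> period_value T s"
    unfolding d_def using assms(1) by (intro gcd_le2_nat) simp
  then have dM: "d < M"
    using assms(2) by (simp add: M_def)
  obtain m where m: "M = d * m"
    unfolding d_def by (meson gcd_dvd1 dvdE)
  have "d > 0" "m \<noteq> 1"
    using m dM by (auto intro: gr0I)
  have complexity: "two_adic_complexity T s = \<lfloor>log 2 (real m)\<rfloor>"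
  proof -
    have "real M / real d = real m"
      using m \<open>d > 0\<close> by simp
    then show ?thesis
      unfolding two_adic_complexity_def d_def M_def by simp
  qed
  obtain r where r: "prime r" "r dvd m"
    using prime_factor_nat[OF \<open>m \<noteq> 1\<close>] by blast
  define q where "q = (LEAST r. prime r \<and> r dvd M)"
  have Mr: "prime r \<and> r dvd M"
    using r m by simp
  have "prime q"
    unfolding q_def using LeastI[of "\<lambda>r. prime r \<and> r dvd M", OF Mr] by blast
  have "q \<le> r"
    unfolding q_def by (rule Least_le[of "\<lambda>r. prime r \<and> r dvd M", OF Mr])
  also have "r \<le> m"
    using r m dM by (intro dvd_imp_le) (auto intro: gr0I)
  finally have "log 2 (real q) \<le> log 2 (real m)"
    using prime_gt_0_nat[OF \<open>prime q\<close>] by (intro log_mono) simp_all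
  then show "two_adic_complexity T s \<ge> \<lfloor>log 2 (real (LEAST r. prime r \<and> r dvd 2 ^ T - 1))\<rfloor>"
    using floor_mono unfolding complexity q_def M_def by blast
  assume "prime (2 ^ T - 1 :: nat)"
  then have "prime M"
    by (simp only: M_def)
  then have "d = 1"
    using m dM prime_nat_iff[of M] by (metis dvd_triv_left less_irrefl)
  then have "m = 2 ^ T - 1"
    using m by (simp add: M_def)
  then have "real m = 2 ^ T - 1"
    by (simp add: of_nat_diff)
  then show "two_adic_complexity T s = \<lfloor>log 2 (2 ^ T - 1)\<rfloor>"
    by (simp only: complexity)
qed

theorem proposition2:
  shows "\<exists>p0 :: nat. \<forall>p \<ge> p0. prime p \<longrightarrow>
    (\<forall>(T :: nat) (q :: nat) (g :: nat \<Rightarrow> nat) (s :: nat \<Rightarrow> nat).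
       T = totient (p - 1) - 1 \<longrightarrow>
       q = (LEAST r. prime r \<and> r dvd 2 ^ T - 1) \<longrightarrow>
       primroot_enumeration p g \<longrightarrow>
       binary_periodic T s \<longrightarrow>
       (\<forall>n<T. [s n = g (n + 1) + g (n + 2)] (mod 2)) \<longrightarrow>
         two_adic_complexity T s \<ge> \<lfloor>log 2 (real q)\<rfloor> \<and>
         (prime (2 ^ T - 1 :: nat) \<longrightarrow>
            two_adic_complexity T s = \<lfloor>log 2 (2 ^ T - 1)\<rfloor>))"
proof -
  obtain p0 where p0: "\<And>p. p \<ge> p0 \<Longrightarrow>
      200 * (2 ^ card (prime_factors (p - 1))) ^ 4 * sqrt (real p) < real p"
    using omega_bound_eventually by blast
  show ?thesis
  \<comment> \<open>Adding 4 secures \<open>p > 3\<close>.\<close>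
  proof (intro exI[of _ "p0 + 4"] allI impI)
    fix p T q :: nat and g s :: "nat \<Rightarrow> nat"
    assume p: "p0 + 4 \<le> p" "prime p" and T: "T = totient (p - 1) - 1"
      and q: "q = (LEAST r. prime r \<and> r dvd 2 ^ T - 1)"
      and enum: "primroot_enumeration p g" and s: "binary_periodic T s"
      and sg: "\<forall>n<T. [s n = g (n + 1) + g (n + 2)] (mod 2)"
    have s01: "s n \<in> {0, 1}" for n
      using s by (simp add: binary_periodic_def)
    \<comment> \<open>The sequence is indexed from 0 and the enumeration from 1, so the pair
      \<open>i\<close>, \<open>i + 1\<close> belongs to \<open>s (i - 1)\<close>; the pairs number
      exactly \<open>T\<close>.\<close>
    have parity: "odd (s (i - 1)) = odd (g i + g (i + 1))" "i - 1 < T"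
      if "1 \<le> i" "i < totient (p - 1)" for i
    proof -
      show "i - 1 < T"
        using that T by simp
      then have "[s (i - 1) = g (i - 1 + 1) + g (i - 1 + 2)] (mod 2)"
        using sg by blast
      moreover have "i - 1 + 1 = i" "i - 1 + 2 = i + 1"
        using that by simp_all
      ultimately show "odd (s (i - 1)) = odd (g i + g (i + 1))"
        by (simp only: cong_def odd_iff_mod_2_eq_one)
    qed
    have large: "200 * (2 ^ card (prime_factors (p - 1))) ^ 4 * sqrt (real p) < real p" "p > 3"
      using p p0 by simp_all
    obtain i j where i: "1 \<le> i" "i < totient (p - 1)" "odd (g i + g (i + 1))"
      and j: "1 \<le> j" "j < totient (p - 1)" "even (g j + g (j + 1))"
      using primroot_parity_patterns[OF p(2) large(2,1) enum] by blast
    have si: "s (i - 1) = 1"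
      using s01[of "i - 1"] parity(1)[OF i(1,2)] i(3) by auto
    have sj: "s (j - 1) = 0"
      using s01[of "j - 1"] parity(1)[OF j(1,2)] j(3) by auto
    note bounds = period_value_bounds[OF s01 parity(2)[OF i(1,2)] si parity(2)[OF j(1,2)] sj]
    show "two_adic_complexity T s \<ge> \<lfloor>log 2 (real q)\<rfloor> \<and>
        (prime (2 ^ T - 1 :: nat) \<longrightarrow> two_adic_complexity T s = \<lfloor>log 2 (2 ^ T - 1)\<rfloor>)"
      unfolding q using two_adic_complexity_ge[OF bounds] by blast
  qed
qed

end
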